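(* Let $q=p^m$, $p$ prime, let $T,\theta$ be functions such that $G=\{\mathfrak{g}_{a,b,c}\}$ is closed under $\circ$ and some $\theta_{a,b,c}$ is nontrivial. Let $t_C\in\mathbb{F}_q$ be such that $g_C:=\sigma_{t_C}$ has order $p^{r_C}$, and set $\mathcal{K}_i^*=\{z\in\mathbb{F}_q:\sigma_z^{p^{r_{A,B}}}=g_C^{ip^{r_{A,B}}}\}$ for $i\ge0$ and $s=\max\{0,r_C-r_{A,B}\}$. If $q$ is even then $r_C\le r_{A,B}+2$. If $q$ is odd, then $r_C\le r_{A,B}+1$, $\mathcal{K}_0^*$ is a $g_C$-invariant $\mathbb{F}_p$-subspace of $\mathbb{F}_q$ of codimension $s$, and $\mathcal{K}_i^*=(1+g_C+\cdots+g_C^{i-1})(t_C)+\mathcal{K}_0^*$ for all $i\ge1$.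
   Context: $T:\mathbb{F}_q^3\to\mathbb{F}_q$, $\theta:\mathbb{F}_q^3\to\mathrm{Aut}(\mathbb{F}_q)$, $\theta_{a,b,c}=\theta(a,b,c)$. $E(a,b,c,t)$ is the matrix with rows $(1,0,0,0),(-c,1,0,0),(b-ct,t,1,0),(a,b,c,1)$; $\mathfrak{g}_{a,b,c}=(E(a,b,c,T(a,b,c)),\theta_{a,b,c})$ with product $(A_1,\sigma_1)\circ(A_2,\sigma_2)=(A_1^{\sigma_2}A_2,\sigma_1\sigma_2)$; $G=\{\mathfrak{g}_{a,b,c}\}$. $\psi:\mathfrak{g}_{a,b,c}\mapsto\theta_{a,b,c}$; $p^{r_{A,B}}$ is the exponent of $\psi(\{\mathfrak{g}_{a,b,0}:a,b\in\mathbb{F}_q\})$. $\sigma_c=\theta_{0,0,c}$ and $p^{r_C}=\max\{o(\sigma_c):c\in\mathbb{F}_q\}$. For $h\in\mathrm{Aut}(\mathbb{F}_q)$, $(1+h+\cdots+h^{i-1})(t)=\sum_{j=0}^{i-1}h^j(t)$. *)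

theory Defs
  imports
    "HOL-Analysis.Analysis"
    "HOL-Algebra.Multiplicative_Group"
    "Berlekamp_Zassenhaus.Finite_Field"
begin

text \<open>Automorphisms act on the right (as in \<open>A\<^sup>\<sigma>\<close>), so the product \<open>\<sigma> \<tau>\<close> applies \<open>\<sigma>\<close> first.\<close>

definition field_aut_group :: "('a::field \<Rightarrow> 'a) monoid" where
  "field_aut_group =
    \<lparr> carrier = {\<sigma>. bij \<sigma> \<and> (\<forall>x y. \<sigma> (x + y) = \<sigma> x + \<sigma> y) \<and> (\<forall>x y. \<sigma> (x * y) = \<sigma> x * \<sigma> y)},
      monoid.mult = (\<lambda>\<sigma> \<tau>. \<tau> \<circ> \<sigma>),
      one = id \<rparr>"

lemma group_field_aut_group: "group (field_aut_group :: ('a::field \<Rightarrow> 'a) monoid)"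
proof (rule groupI)
  fix \<sigma> :: "'a \<Rightarrow> 'a"
  assume \<sigma>: "\<sigma> \<in> carrier field_aut_group"
  then have b: "bij \<sigma>" and add: "\<And>x y. \<sigma> (x + y) = \<sigma> x + \<sigma> y"
    and mult: "\<And>x y. \<sigma> (x * y) = \<sigma> x * \<sigma> y"
    by (auto simp: field_aut_group_def)
  have 1: "inv_into UNIV \<sigma> (x + y) = inv_into UNIV \<sigma> x + inv_into UNIV \<sigma> y" for x y
    by (metis b add bij_inv_eq_iff)
  have 2: "inv_into UNIV \<sigma> (x * y) = inv_into UNIV \<sigma> x * inv_into UNIV \<sigma> y" for x y
    by (metis b mult bij_inv_eq_iff)
  have "inv_into UNIV \<sigma> \<in> carrier field_aut_group"
    using 1 2 bij_imp_bij_inv[OF b] by (simp add: field_aut_group_def)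
  moreover have "\<sigma> \<circ> inv_into UNIV \<sigma> = id"
    using b by (simp add: bij_is_surj surj_iff[symmetric])
  ultimately show "\<exists>\<tau>\<in>carrier field_aut_group. \<tau> \<otimes>\<^bsub>field_aut_group\<^esub> \<sigma> = \<one>\<^bsub>field_aut_group\<^esub>"
    by (intro bexI[of _ "inv_into UNIV \<sigma>"]) (simp_all add: field_aut_group_def)
qed (auto simp: field_aut_group_def bij_comp)

definition exponent_in :: "('g, 'm) monoid_scheme \<Rightarrow> 'g set \<Rightarrow> nat" where
  "exponent_in G S = (LEAST n. 0 < n \<and> (\<forall>x\<in>S. x [^]\<^bsub>G\<^esub> n = \<one>\<^bsub>G\<^esub>))"

definition E_mat :: "'a::field \<Rightarrow> 'a \<Rightarrow> 'a \<Rightarrow> 'a \<Rightarrow> 'a^4^4" where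
  "E_mat a b c t = vector
    [vector [1,         0, 0, 0],
     vector [- c,       1, 0, 0],
     vector [b - c * t, t, 1, 0],
     vector [a,         b, c, 1]]"

definition semilin_mult ::
  "(('a::field)^4^4) \<times> ('a \<Rightarrow> 'a) \<Rightarrow> ('a^4^4) \<times> ('a \<Rightarrow> 'a) \<Rightarrow> ('a^4^4) \<times> ('a \<Rightarrow> 'a)" where
  "semilin_mult g h =
    (map_matrix (snd h) (fst g) ** fst h, snd g \<otimes>\<^bsub>field_aut_group\<^esub> snd h)"

definition g_elem ::
  "('a::field \<Rightarrow> 'a \<Rightarrow> 'a \<Rightarrow> 'a) \<Rightarrow> ('a \<Rightarrow> 'a \<Rightarrow> 'a \<Rightarrow> 'a \<Rightarrow> 'a) \<Rightarrow> 'a \<Rightarrow> 'a \<Rightarrow> 'a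
    \<Rightarrow> ('a^4^4) \<times> ('a \<Rightarrow> 'a)" where
  "g_elem T \<theta> a b c = (E_mat a b c (T a b c), \<theta> a b c)"

definition G_set ::
  "('a::field \<Rightarrow> 'a \<Rightarrow> 'a \<Rightarrow> 'a) \<Rightarrow> ('a \<Rightarrow> 'a \<Rightarrow> 'a \<Rightarrow> 'a \<Rightarrow> 'a) \<Rightarrow> (('a^4^4) \<times> ('a \<Rightarrow> 'a)) set" where
  "G_set T \<theta> = {g_elem T \<theta> a b c | a b c. True}"

text \<open>The map \<open>\<psi>\<close> sending \<open>g_elem T \<theta> a b c\<close> to \<open>\<theta> a b c\<close> is \<^const>\<open>snd\<close>.\<close>

definition psi_AB ::
  "('a::field \<Rightarrow> 'a \<Rightarrow> 'a \<Rightarrow> 'a) \<Rightarrow> ('a \<Rightarrow> 'a \<Rightarrow> 'a \<Rightarrow> 'a \<Rightarrow> 'a) \<Rightarrow> ('a \<Rightarrow> 'a) set" where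
  "psi_AB T \<theta> = snd ` {g_elem T \<theta> a b 0 | a b. True}"

definition sigma_C :: "('a::field \<Rightarrow> 'a \<Rightarrow> 'a \<Rightarrow> 'a \<Rightarrow> 'a) \<Rightarrow> 'a \<Rightarrow> 'a \<Rightarrow> 'a" where
  "sigma_C \<theta> c = \<theta> 0 0 c"

text \<open>With \<open>p = CARD('p)\<close> prime, the type \<open>'p mod_ring\<close> is the field with \<open>p\<close> elements. The map below
  is its scalar action on a field of characteristic \<open>p\<close>, through the embedding of the prime field.\<close>

definition prime_scale :: "'p::prime_card mod_ring \<Rightarrow> 'a::field \<Rightarrow> 'a" where
  "prime_scale k x = of_int (to_int_mod_ring k) * x"

lemma vector_space_prime_scale:
  assumes "CARD('a::{field,finite}) = CARD('p::prime_card) ^ m"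
  shows "vector_space (prime_scale :: 'p mod_ring \<Rightarrow> 'a \<Rightarrow> 'a)"
proof -
  have "CHAR('a) dvd CARD('p) ^ m"
    using CHAR_dvd_CARD[where ?'a = 'a] assms by simp
  then have "(of_nat (CARD('p)) :: 'a) ^ m = 0"
    by (metis of_nat_power of_nat_eq_0_iff_char_dvd)
  then have p0: "(of_int (int CARD('p)) :: 'a) = 0"
    by simp
  have md: "(of_int (z mod int CARD('p)) :: 'a) = of_int z" for z
  proof -
    have "(of_int z :: 'a) = of_int (int CARD('p) * (z div int CARD('p)) + z mod int CARD('p))"
      by simp
    also have "\<dots> = of_int (z mod int CARD('p))"
      unfolding of_int_add of_int_mult p0 by simp
    finally show ?thesis by simp
  qed
  have add: "to_int_mod_ring (k + l) = (to_int_mod_ring k + to_int_mod_ring l) mod int CARD('p)"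
    and mult: "to_int_mod_ring (k * l) = (to_int_mod_ring k * to_int_mod_ring l) mod int CARD('p)"
    for k l :: "'p mod_ring"
    by (transfer, simp)+
  show ?thesis
    by unfold_locales (simp_all only: prime_scale_def add mult md of_int_add of_int_mult
        to_int_mod_ring_hom.hom_one of_int_1 mult_1 distrib_left distrib_right mult.assoc)
qed

end

theory Submission
  imports Defs
begin

text \<open>
  Reading products off the last row of the matrices makes \<open>G\<close> a group of order \<open>q\<^sup>3\<close> on which
  \<open>\<theta>\<close> is a homomorphism into the cyclic group \<open>Aut(F\<^sub>q)\<close> and the coordinate \<open>c\<close> is a
  cocycle: \<open>c (x y) = \<theta>\<^sub>y (c x) + c y\<close>. Put \<open>N = p^r\<^sub>A\<^sub>B\<close>. Since \<open>Aut(F\<^sub>q)\<close> is cyclic, the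
  automorphisms killed by \<open>N\<close> are exactly the \<open>\<theta>\<^sub>x\<close> with \<open>c x = 0\<close>. It follows that
  \<open>K\<^sub>0\<^sup>* = c (ker \<theta>)\<close>, that this is an additive subgroup invariant under all \<open>\<theta>\<^sub>y\<close>, and that
  \<open>\<theta>\<^sub>x\<^sup>N = \<theta>\<^sub>y\<^sup>N\<close> iff \<open>c x - c y \<in> K\<^sub>0\<^sup>*\<close>. As \<open>c (x\<^sup>i) = (1 + \<theta>\<^sub>x + \<dots> + \<theta>\<^sub>x\<^sup>i\<^sup>-\<^sup>1) (c x)\<close>, the
  sets \<open>K\<^sub>i\<^sup>*\<close> are the cosets described, and there are \<open>p\<^sup>s\<close> of them.

  For the bounds let \<open>D = g\<^sub>C - 1\<close>. It is nilpotent, so it is nilpotent of index at most \<open>s\<close> on the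
  \<open>s\<close>-dimensional quotient \<open>F\<^sub>q / K\<^sub>0\<^sup>*\<close>. In characteristic \<open>p\<close> the sum
  \<open>1 + g\<^sub>C + \<dots> + g\<^sub>C\<^sup>n\<^sup>-\<^sup>1\<close> with \<open>n = p\<^sup>s\<^sup>-\<^sup>1\<close> equals \<open>D\<^sup>n\<^sup>-\<^sup>1\<close>, and it does not send \<open>t\<^sub>C\<close> into
  \<open>K\<^sub>0\<^sup>*\<close>. Hence \<open>p\<^sup>s\<^sup>-\<^sup>1 \<le> s\<close>, which forces \<open>s \<le> 2\<close>, and \<open>s \<le> 1\<close> for odd \<open>p\<close>.
\<close>

section \<open>Automorphisms of finite fields\<close>

text \<open>With h = \<phi>^b the order of h is \<open>ord \<phi> div gcd b (ord \<phi>)\<close>, so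
  the condition on x = \<phi>^a forces this gcd to divide a, and Bezout writes the gcd as a multiple
  of b modulo \<open>ord \<phi>\<close>.\<close>

lemma (in group) pow_ord_eq_one_imp_power:
  assumes \<phi>: "\<phi> \<in> carrier G" "ord \<phi> > 0" and gen: "\<And>y. y \<in> carrier G \<Longrightarrow> \<exists>i::nat. y = \<phi> [^] i"
    and h: "h \<in> carrier G" and x: "x \<in> carrier G" "x [^] ord h = \<one>"
  shows "\<exists>j::nat. x = h [^] j"
proof -
  obtain a b :: nat where a: "x = \<phi> [^] a" and b: "h = \<phi> [^] b"
    using gen h x by metis
  show ?thesis
  proof (cases "b = 0")
    case True
    then have "x = \<one>" using b x by simp
    then show ?thesis by (intro exI[of _ 0]) simp
  next
    case False
    let ?M = "ord \<phi>"
    let ?d = "gcd b ?M"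
    have d: "?d > 0" using False by simp
    have M: "?M = ?M div ?d * ?d" by simp
    have ord_h: "ord h = ?M div ?d"
      using ord_pow_gen[OF \<phi>(1), of b] False by (simp add: b gcd.commute)
    have "?M dvd a * ord h"
      using x \<phi> by (simp add: a nat_pow_pow pow_eq_id)
    then have "?M div ?d * ?d dvd ?M div ?d * a"
      unfolding ord_h using M by (metis mult.commute)
    then have "?d dvd a"
      using \<phi>(2) M by (metis nat_mult_dvd_cancel_disj mult_0 less_irrefl)
    then obtain e where e: "a = ?d * e" by auto
    obtain u v where uv: "b * u = ?M * v + ?d"
      using bezout_nat[OF False, of ?M] by blast
    have "h [^] (u * e) = \<phi> [^] (?M * (v * e) + a)"
      using \<phi> uv e by (simp add: b nat_pow_pow) (metis add_mult_distrib mult.assoc)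
    also have "\<dots> = x"
      using \<phi> by (simp add: a flip: nat_pow_mult nat_pow_pow)
    finally show ?thesis by metis
  qed
qed

lemma field_aut_pow: "\<sigma> [^]\<^bsub>field_aut_group\<^esub> (n::nat) = \<sigma> ^^ n"
  by (induction n) (simp_all add: field_aut_group_def nat_pow_def)

lemma
  assumes "\<sigma> \<in> carrier field_aut_group"
  shows field_aut_add: "\<sigma> (x + y) = \<sigma> x + \<sigma> y"
    and field_aut_mult: "\<sigma> (x * y) = \<sigma> x * \<sigma> y"
    and field_aut_bij: "bij \<sigma>"
  using assms by (auto simp: field_aut_group_def)

lemma field_aut_comm_ring_hom:
  assumes "\<sigma> \<in> carrier field_aut_group"
  shows "comm_ring_hom \<sigma>"
proof -
  note add = field_aut_add[OF assms] and mult = field_aut_mult[OF assms]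
  have 0: "\<sigma> 0 = 0" using add[of 0 0] by (metis add.right_neutral add_left_cancel)
  have "\<sigma> 1 \<noteq> 0"
    using 0 bij_is_inj[OF field_aut_bij[OF assms]] by (metis injD zero_neq_one)
  then have "\<sigma> 1 = 1" using mult[of 1 1] by simp
  with 0 add mult show ?thesis by unfold_locales auto
qed

text \<open>The type-class field is repackaged as a HOL-Algebra record to inherit the cyclicity of
  its multiplicative group.\<close>

lemma finite_field_cyclic:
  obtains a :: "'a::{field,finite}" where "\<And>x. x \<noteq> 0 \<Longrightarrow> \<exists>i::nat. x = a ^ i"
proof -
  define R :: "'a ring" where
    "R = \<lparr>carrier = UNIV, monoid.mult = (*), one = 1, ring.zero = 0, add = (+)\<rparr>"
  interpret R: field R
  proof -
    have "\<exists>y. x + y = 0" for x :: 'a using add.right_inverse by blast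
    moreover have "x \<noteq> 0 \<Longrightarrow> \<exists>y. x * y = 1" for x :: 'a by (rule exI[of _ "inverse x"]) auto
    ultimately show "field R"
      unfolding R_def by unfold_locales (auto simp: algebra_simps Units_def)
  qed
  have pow: "a [^]\<^bsub>R\<^esub> i = a ^ i" for a and i :: nat
    by (induction i) (simp_all add: R_def nat_pow_def mult.commute)
  from R.finite_field_mult_group_has_gen obtain a :: 'a
    where "carrier (mult_of R) = {a [^]\<^bsub>R\<^esub> i | i::nat. i \<in> UNIV}"
    by (auto simp: R_def)
  then have "UNIV - {0} = {a ^ i | i::nat. True}"
    by (simp add: pow) (simp add: R_def)
  then show ?thesis using that[of a] by auto
qed

lemma prime_CHAR_finite_field: "prime CHAR('a::{field,finite})"
  by (intro prime_CHAR_semidom finite_imp_CHAR_pos) simp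

text \<open>Additivity gives injectivity: applied to y + (x - y), equal powers yield (x - y)^(p^i) =
  0. Finiteness gives surjectivity.\<close>

lemma power_CHAR_pow_in_field_aut_group:
  "(\<lambda>x::'a::{field,finite}. x ^ (CHAR('a) ^ i)) \<in> carrier field_aut_group"
proof -
  note prime = prime_CHAR_finite_field[where 'a = 'a]
  have "x = y" if "x ^ (CHAR('a) ^ i) = y ^ (CHAR('a) ^ i)" for x y :: 'a
  proof -
    have "y ^ (CHAR('a) ^ i) + (x - y) ^ (CHAR('a) ^ i) = x ^ (CHAR('a) ^ i)"
      using freshmans_dream'[OF prime refl, of y "x - y" i] by simp
    with that show ?thesis by simp
  qed
  then have "bij (\<lambda>x::'a. x ^ (CHAR('a) ^ i))"
    by (intro finite_UNIV_inj_surj bijI) (auto intro: injI finite_UNIV_inj_surj)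
  then show ?thesis
    by (simp add: field_aut_group_def freshmans_dream'[OF prime refl] power_mult_distrib)
qed

text \<open>By Fermat the p elements of the prime field are already roots of X^p - X, which has at
  most p roots.\<close>

lemma power_CHAR_eq_imp_of_nat:
  assumes "x ^ CHAR('a) = (x :: 'a::{field,finite})"
  shows "\<exists>n. x = of_nat n"
proof -
  note prime = prime_CHAR_finite_field[where 'a = 'a]
  have pos: "CHAR('a) > 1" using prime_gt_1_nat[OF prime] .
  let ?P = "Polynomial.monom 1 CHAR('a) - [:0, 1:] :: 'a poly"
  let ?N = "(of_nat :: nat \<Rightarrow> 'a) ` {..<CHAR('a)}"
  have P: "poly ?P y = y ^ CHAR('a) - y" for y by (simp add: poly_monom)
  have nz: "?P \<noteq> 0"
  proof
    assume "?P = 0"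
    then have "Polynomial.coeff ?P CHAR('a) = 0" by simp
    with pos show False by (simp add: coeff_pCons split: nat.splits)
  qed
  have deg: "degree ?P \<le> CHAR('a)"
    using pos by (intro degree_diff_le) (auto simp: degree_monom_le)
  have fermat: "(of_nat n :: 'a) ^ CHAR('a) = of_nat n" for n
    by (induction n) (use prime in \<open>simp_all add: freshmans_dream prime_gt_0_nat\<close>)
  have "card ?N = CHAR('a)"
    by (subst card_image) (auto intro!: inj_onI simp: of_nat_eq_iff_cong_CHAR cong_def)
  moreover have "?N \<subseteq> {y. poly ?P y = 0}"
    unfolding P by (auto simp: fermat)
  moreover have "card {y. poly ?P y = 0} \<le> CHAR('a)"
    using card_poly_roots_bound[OF nz] deg by linarith
  ultimately have "?N = {y. poly ?P y = 0}"
    by (intro card_seteq) auto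
  moreover have "x \<in> {y. poly ?P y = 0}" unfolding P using assms by simp
  ultimately show ?thesis by auto
qed

text \<open>The product of \<open>X - a^(p^i)\<close> over the Frobenius orbit of a primitive element \<open>a\<close> has
  coefficients in the prime field, so every automorphism permutes its roots.\<close>

lemma field_aut_eq_power_CHAR_pow:
  assumes \<sigma>: "\<sigma> \<in> carrier (field_aut_group :: ('a::{field,finite} \<Rightarrow> 'a) monoid)"
  shows "\<exists>i. \<sigma> = (\<lambda>x. x ^ (CHAR('a) ^ i))"
proof -
  interpret A: group "field_aut_group :: ('a \<Rightarrow> 'a) monoid" by (rule group_field_aut_group)
  obtain a :: 'a where a: "\<And>x. x \<noteq> 0 \<Longrightarrow> \<exists>i::nat. x = a ^ i"
    using finite_field_cyclic by blast
  define \<phi> :: "'a \<Rightarrow> 'a" where "\<phi> = (\<lambda>x. x ^ CHAR('a))"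
  have \<phi>: "\<phi> \<in> carrier field_aut_group"
    using power_CHAR_pow_in_field_aut_group[of 1] by (simp add: \<phi>_def)
  \<comment> \<open>With the group order as length, \<phi>^m = id by Lagrange; the product
    \<open>F\<close> may repeat factors, which does no harm.\<close>
  define m where "m = order (field_aut_group :: ('a \<Rightarrow> 'a) monoid)"
  have m: "m > 0" unfolding m_def by (subst A.order_gt_0_iff_finite) simp
  have \<phi>_pow: "\<phi> ^^ i = (\<lambda>x. x ^ (CHAR('a) ^ i))" for i
    by (induction i) (simp_all add: \<phi>_def fun_eq_iff mult.commute flip: power_mult)
  have "\<phi> [^]\<^bsub>field_aut_group\<^esub> m = \<one>\<^bsub>field_aut_group\<^esub>"
    unfolding m_def by (rule A.pow_order_eq_1[OF \<phi>])
  then have \<phi>_m: "(\<phi> ^^ m) x = x" for x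
    by (simp add: field_aut_pow) (simp add: field_aut_group_def)
  interpret \<phi>: comm_ring_hom \<phi> by (rule field_aut_comm_ring_hom[OF \<phi>])
  interpret \<phi>p: map_poly_comm_ring_hom \<phi> ..
  interpret \<sigma>: comm_ring_hom \<sigma> by (rule field_aut_comm_ring_hom[OF \<sigma>])
  define F where "F = (\<Prod>i<m. [:- (\<phi> ^^ i) a, 1:])"
  have "map_poly \<phi> F = (\<Prod>i<m. [:- (\<phi> ^^ Suc i) a, 1:])"
    unfolding F_def by (simp add: \<phi>p.hom_prod hom_distribs)
  also have "\<dots> = F"
  proof -
    \<comment> \<open>\<phi> shifts the index of each factor by one, and the new last factor is the
      old first one because \<phi>^m fixes a.\<close>
    obtain n where n: "m = Suc n" using m by (cases m) auto
    show ?thesis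
      using prod.lessThan_Suc[of "\<lambda>i. [:- (\<phi> ^^ Suc i) a, 1:]" n] \<phi>_m[of a]
      unfolding F_def n prod.lessThan_Suc_shift[of "\<lambda>i. [:- (\<phi> ^^ i) a, 1:]" n] o_def
      by (simp add: mult.commute)
  qed
  finally have "\<phi> (Polynomial.coeff F n) = Polynomial.coeff F n" for n
    by (metis \<phi>.coeff_map_poly_hom)
  then have "\<exists>k. Polynomial.coeff F n = of_nat k" for n
    using power_CHAR_eq_imp_of_nat[of "Polynomial.coeff F n"] by (simp add: \<phi>_def)
  then have "\<sigma> (Polynomial.coeff F n) = Polynomial.coeff F n" for n
    by (metis \<sigma>.hom_of_nat)
  then have "map_poly \<sigma> F = F"
    by (intro poly_eqI) simp
  moreover have "poly F a = 0"
    using m by (auto simp: F_def poly_prod prod_zero_iff intro!: bexI[of _ 0])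
  ultimately have "poly F (\<sigma> a) = 0"
    by (metis \<sigma>.poly_map_poly \<sigma>.hom_zero)
  then obtain i where i: "\<sigma> a = (\<phi> ^^ i) a"
    by (auto simp: F_def poly_prod prod_zero_iff)
  have "\<sigma> x = x ^ (CHAR('a) ^ i)" for x
  proof (cases "x = 0")
    case True
    have "CHAR('a) > 0" by (rule finite_imp_CHAR_pos) simp
    with True show ?thesis by simp
  next
    case False
    then obtain k where "x = a ^ k" using a by blast
    then show ?thesis
      using i by (simp add: \<phi>_pow \<sigma>.hom_power power_mult[symmetric] mult.commute)
  qed
  then show ?thesis by blast
qed

lemma field_aut_comm:
  assumes "\<sigma> \<in> carrier (field_aut_group :: ('a::{field,finite} \<Rightarrow> 'a) monoid)"
    and "\<tau> \<in> carrier field_aut_group"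
  shows "\<sigma> \<otimes>\<^bsub>field_aut_group\<^esub> \<tau> = \<tau> \<otimes>\<^bsub>field_aut_group\<^esub> \<sigma>"
  using field_aut_eq_power_CHAR_pow[OF assms(1)] field_aut_eq_power_CHAR_pow[OF assms(2)]
  by (auto simp: field_aut_group_def mult.commute simp flip: power_mult)

lemma field_aut_pow_ord_eq_one_imp_power:
  assumes h: "h \<in> carrier (field_aut_group :: ('a::{field,finite} \<Rightarrow> 'a) monoid)"
    and x: "x \<in> carrier field_aut_group"
    and "x [^]\<^bsub>field_aut_group\<^esub> group.ord field_aut_group h = \<one>\<^bsub>field_aut_group\<^esub>"
  shows "\<exists>j::nat. x = h [^]\<^bsub>field_aut_group\<^esub> j"
proof -
  interpret A: group "field_aut_group :: ('a \<Rightarrow> 'a) monoid" by (rule group_field_aut_group)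
  let ?\<phi> = "\<lambda>x::'a. x ^ CHAR('a)"
  have \<phi>: "?\<phi> \<in> carrier field_aut_group"
    using power_CHAR_pow_in_field_aut_group[of 1] by simp
  have \<phi>_pow: "?\<phi> ^^ i = (\<lambda>x. x ^ (CHAR('a) ^ i))" for i
    by (induction i) (simp_all add: fun_eq_iff mult.commute flip: power_mult)
  show ?thesis
  proof (rule A.pow_ord_eq_one_imp_power[OF \<phi> _ _ h x assms(3)])
    show "A.ord ?\<phi> > 0" using A.ord_ge_1[OF _ \<phi>] by simp
    show "\<exists>i::nat. y = ?\<phi> [^]\<^bsub>field_aut_group\<^esub> i" if "y \<in> carrier field_aut_group" for y
      using field_aut_eq_power_CHAR_pow[OF that] by (simp add: field_aut_pow \<phi>_pow)
  qed
qed

section \<open>Unipotent operators in characteristic \<open>p\<close>\<close>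

text \<open>In j * C(p^k, j) = p^k * C(p^k - 1, j - 1), a binomial coefficient prime to p would
  leave p^k dividing j, which is too small.\<close>

lemma prime_dvd_choose_prime_power:
  fixes p j k :: nat
  assumes "prime p" "0 < j" "j < p ^ k"
  shows "p dvd (p ^ k choose j)"
proof (rule ccontr)
  assume "\<not> p dvd (p ^ k choose j)"
  then have "coprime (p ^ k) (p ^ k choose j)"
    using assms(1) by (simp add: prime_imp_coprime)
  moreover have "p ^ k dvd j * (p ^ k choose j)"
    using times_binomial_minus1_eq[OF assms(2)] by simp
  ultimately have "p ^ k dvd j"
    by (simp add: coprime_dvd_mult_left_iff)
  with assms(2,3) show False by (auto dest: dvd_imp_le)
qed

lemma additive_of_nat_mult:
  fixes f :: "'a::comm_ring_1 \<Rightarrow> 'a"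
  assumes "Modules.additive f"
  shows "f (of_nat n * x) = of_nat n * f x"
  by (induction n)
    (simp_all add: additive.zero[OF assms] additive.add[OF assms] distrib_right)

lemma additive_funpow:
  fixes f :: "'a::ab_group_add \<Rightarrow> 'a"
  assumes "Modules.additive f"
  shows "Modules.additive (f ^^ n)"
  by (induction n) (use assms in \<open>auto simp: Modules.additive_def\<close>)

text \<open>This is ((1 + D)^n - 1) / D written without division, where g = 1 + D. The induction
  uses S(n + 1) = 1 + g S(n) and Pascal's rule.\<close>

lemma sum_funpow_eq_binomial_sum:
  fixes g :: "'a::comm_ring_1 \<Rightarrow> 'a"
  assumes "Modules.additive g"
  defines "D \<equiv> \<lambda>x. g x - x"
  shows "(\<Sum>i<n. (g ^^ i) x) = (\<Sum>k<n. of_nat (n choose Suc k) * (D ^^ k) x)"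
proof (induction n)
  case (Suc n)
  interpret g: additive g by fact
  interpret D: additive D by unfold_locales (simp add: D_def g.add)
  let ?S = "\<Sum>k<n. of_nat (n choose Suc k) * (D ^^ k) x"
  have "(\<Sum>i<Suc n. (g ^^ i) x) = x + g (\<Sum>i<n. (g ^^ i) x)"
    by (simp add: sum.lessThan_Suc_shift g.sum del: sum.lessThan_Suc)
  also have "\<dots> = x + ?S + D ?S"
    unfolding Suc.IH by (simp add: D_def)
  also have "D ?S = (\<Sum>k<n. of_nat (n choose Suc k) * (D ^^ Suc k) x)"
    by (simp add: D.sum additive_of_nat_mult[OF D.additive_axioms])
  also have "x + ?S + \<dots> = (\<Sum>k<Suc n. of_nat (n choose k) * (D ^^ k) x) + ?S"
    by (simp add: sum.lessThan_Suc_shift del: sum.lessThan_Suc)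
  \<comment> \<open>Adding the zero term at k = n aligns the ranges for Pascal's rule.\<close>
  also have "?S = (\<Sum>k<Suc n. of_nat (n choose Suc k) * (D ^^ k) x)"
    by (simp add: binomial_eq_0)
  also have "(\<Sum>k<Suc n. of_nat (n choose k) * (D ^^ k) x) + \<dots>
    = (\<Sum>k<Suc n. of_nat (Suc n choose Suc k) * (D ^^ k) x)"
    by (simp add: distrib_right sum.distrib algebra_simps del: sum.lessThan_Suc)
  finally show ?case .
qed simp

text \<open>Modulo p every coefficient C(p^k, j + 1) vanishes except the last, which is 1.\<close>

lemma sum_funpow_prime_power:
  fixes g :: "'a::comm_ring_1 \<Rightarrow> 'a"
  assumes "Modules.additive g" and p: "prime p" "of_nat p = (0 :: 'a)"
  shows "(\<Sum>i<p ^ k. (g ^^ i) x) = ((\<lambda>x. g x - x) ^^ (p ^ k - 1)) x"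
proof -
  obtain n where n: "p ^ k = Suc n"
    using p(1) by (metis not0_implies_Suc power_not_zero not_prime_0)
  have "of_nat (Suc n choose Suc j) = (0 :: 'a)" if "j < n" for j
    using prime_dvd_choose_prime_power[OF p(1), of "Suc j" k] that n p(2)
    by (metis Suc_less_eq dvdE mult_zero_left of_nat_mult zero_less_Suc)
  then show ?thesis
    unfolding n sum_funpow_eq_binomial_sum[OF assms(1)] by (simp del: binomial_Suc_Suc)
qed

text \<open>Applying g - 1 once more to the sum of the previous lemma makes it telescope.\<close>

lemma funpow_diff_prime_power:
  fixes g :: "'a::comm_ring_1 \<Rightarrow> 'a"
  assumes "Modules.additive g" and p: "prime p" "of_nat p = (0 :: 'a)"
  shows "((\<lambda>x. g x - x) ^^ (p ^ k)) x = (g ^^ (p ^ k)) x - x"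
proof -
  obtain n where n: "p ^ k = Suc n"
    using p(1) by (metis not0_implies_Suc power_not_zero not_prime_0)
  have "((\<lambda>x. g x - x) ^^ (p ^ k)) x = g (\<Sum>i<p ^ k. (g ^^ i) x) - (\<Sum>i<p ^ k. (g ^^ i) x)"
    by (simp only: sum_funpow_prime_power[OF assms]) (simp add: n)
  also have "\<dots> = (\<Sum>i<p ^ k. (g ^^ Suc i) x - (g ^^ i) x)"
    by (simp add: additive.sum[OF assms(1)] sum_subtractf)
  also have "\<dots> = (g ^^ (p ^ k)) x - x"
    by (subst sum_lessThan_telescope) simp
  finally show ?thesis .
qed

section \<open>Counting and subspaces over the prime field\<close>

text \<open>A vector of the enlarged span is uniquely a multiple of b plus an element of
  \<open>span B\<close>, so each basis vector multiplies the size by that of the scalar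
  field.\<close>

lemma (in vector_space) card_span_independent:
  assumes "finite B" "independent B" "finite (UNIV :: 'a set)"
  shows "card (span B) = CARD('a) ^ card B"
  using assms(1,2)
proof (induction B rule: finite_induct)
  case (insert b B)
  then have b: "b \<notin> span B" and B: "independent B"
    by (auto simp: independent_insert)
  let ?f = "\<lambda>(k, y). scale k b + y"
  have "inj_on ?f (UNIV \<times> span B)"
  proof (rule inj_onI, clarify)
    fix k l y z
    assume yz: "y \<in> span B" "z \<in> span B" and eq: "scale k b + y = scale l b + z"
    have "scale (k - l) b = z - y"
      using eq by (simp add: scale_left_diff_distrib algebra_simps)
    then have "scale (k - l) b \<in> span B" using yz by (simp add: span_diff)
    then have "k = l" using b using span_scale[of "scale (k - l) b" B "inverse (k - l)"]
      by (cases "k = l") auto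
    then show "k = l \<and> y = z" using eq by simp
  qed
  moreover have "span (insert b B) = ?f ` (UNIV \<times> span B)"
  proof (intro equalityI subsetI)
    fix x assume "x \<in> span (insert b B)"
    then obtain k where "x - scale k b \<in> span B" by (auto simp: span_breakdown_eq)
    then show "x \<in> ?f ` (UNIV \<times> span B)"
      by (intro image_eqI[of _ _ "(k, x - scale k b)"]) auto
  next
    fix x assume "x \<in> ?f ` (UNIV \<times> span B)"
    then obtain k y where "y \<in> span B" "x = scale k b + y" by auto
    then show "x \<in> span (insert b B)"
      by (auto simp: span_breakdown_eq intro!: exI[of _ k])
  qed
  ultimately show ?case
    using insert B by (simp add: card_image card_cartesian_product)
qed simp

lemma (in vector_space) card_subspace:
  assumes "subspace S" "finite S" "finite (UNIV :: 'a set)"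
  shows "card S = CARD('a) ^ dim S"
proof -
  obtain B where B: "B \<subseteq> S" "independent B" "S \<subseteq> span B" "card B = dim S"
    by (rule basis_exists)
  then have "span B = S" using assms(1) by (simp add: span_subspace)
  then show ?thesis
    using card_span_independent[OF finite_subset[OF B(1) assms(2)] B(2) assms(3)] B(4) by simp
qed

text \<open>A scalar of the prime field acts by repeated addition.\<close>

lemma add_closed_imp_subspace_prime_scale:
  fixes S :: "'a::{field,finite} set"
  assumes "CARD('a) = CARD('p::prime_card) ^ m"
    and 0: "0 \<in> S" and add: "\<And>x y. x \<in> S \<Longrightarrow> y \<in> S \<Longrightarrow> x + y \<in> S"
  shows "module.subspace (prime_scale :: 'p mod_ring \<Rightarrow> 'a \<Rightarrow> 'a) S"
proof -
  interpret vector_space "prime_scale :: 'p mod_ring \<Rightarrow> 'a \<Rightarrow> 'a"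
    by (rule vector_space_prime_scale[OF assms(1)])
  have nat: "of_nat n * x \<in> S" if "x \<in> S" for n x
    by (induction n) (use 0 add that in \<open>simp_all add: distrib_right\<close>)
  have "prime_scale k x \<in> S" if "x \<in> S" for k :: "'p mod_ring" and x
  proof -
    have "0 \<le> to_int_mod_ring k" using range_to_int_mod_ring[where 'a = 'p] by auto
    then have "prime_scale k x = of_nat (nat (to_int_mod_ring k)) * x"
      by (simp add: prime_scale_def)
    then show ?thesis using nat[OF that] by simp
  qed
  with 0 add show ?thesis by (intro subspaceI) auto
qed

section \<open>Nilpotency on the quotient by an invariant subspace\<close>

lemma of_nat_CARD_eq_0:
  assumes "CARD('a::{field,finite}) = p ^ m"
  shows "of_nat p = (0 :: 'a)"
proof -
  have "CHAR('a) dvd p ^ m" using CHAR_dvd_CARD[where ?'a = 'a] assms by simp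
  then show ?thesis by (metis of_nat_power of_nat_eq_0_iff_char_dvd power_eq_0_iff)
qed

text \<open>The preimages of \<open>K\<close> under the powers of \<open>D\<close> form a chain that grows by a factor of at least
  \<open>p\<close> at every step until it reaches the whole field, because \<open>D\<close> is nilpotent.\<close>

lemma funpow_diff_mem_subgroup:
  fixes g :: "'a::{field,finite} \<Rightarrow> 'a"
  assumes card: "CARD('a) = CARD('p::prime_card) ^ m"
    and g: "Modules.additive g" and period: "\<And>x. (g ^^ (CARD('p) ^ r)) x = x"
    and K: "module.subspace (prime_scale :: 'p mod_ring \<Rightarrow> 'a \<Rightarrow> 'a) K" "g ` K \<subseteq> K"
    and index: "CARD('a) = CARD('p) ^ s * card K"
  shows "((\<lambda>x. g x - x) ^^ s) x \<in> K"
proof -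
  interpret vector_space "prime_scale :: 'p mod_ring \<Rightarrow> 'a \<Rightarrow> 'a"
    by (rule vector_space_prime_scale[OF card])
  define p where "p = CARD('p)"
  have p: "prime p" unfolding p_def by (rule prime_card)
  define D where "D = (\<lambda>x. g x - x)"
  interpret D: additive D
    by unfold_locales (simp add: D_def additive.add[OF g])
  define U where "U j = {x. (D ^^ j) x \<in> K}" for j
  have U_Suc: "U (Suc j) = {x. D x \<in> U j}" for j
    by (simp add: U_def funpow_Suc_right del: funpow.simps)
  have "Modules.additive (D ^^ j)" for j by (rule additive_funpow[OF D.additive_axioms])
  then have "subspace (U j)" for j
    by (intro add_closed_imp_subspace_prime_scale[OF card])
      (auto simp: U_def additive.zero additive.add subspace_0[OF K(1)] subspace_add[OF K(1)])
  then have card_U: "card (U j) = p ^ dim (U j)" for j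
    using card_subspace[of "U j"] by (simp add: p_def)
  have "D x \<in> K" if "x \<in> K" for x
    using that K by (auto simp: D_def intro!: subspace_diff)
  then have mono: "U j \<subseteq> U (Suc j)" for j by (auto simp: U_def)
  have all: "U (j + p ^ r) = UNIV" for j
  proof -
    have "(D ^^ (p ^ r)) x = 0" for x
      using funpow_diff_prime_power[OF g p, of r x] of_nat_CARD_eq_0[OF card] period[of x]
      by (simp add: D_def p_def)
    then show ?thesis
      using additive.zero[OF additive_funpow[OF D.additive_axioms]] subspace_0[OF K(1)]
      by (auto simp: U_def funpow_add)
  qed
  \<comment> \<open>\<open>U (Suc j)\<close> is determined by \<open>U j\<close>, so a chain that
    stalls once stays constant; until it fills the field it must grow strictly.\<close>
  have stable: "U (j + i) = U j" if "U (Suc j) = U j" for i j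
    by (induction i) (use that U_Suc in auto)
  have step: "U j = UNIV \<or> p ^ j * card K \<le> card (U j)" for j
  proof (induction j)
    case 0
    then show ?case by (simp add: U_def)
  next
    case (Suc j)
    show ?case
    proof (cases "U j = UNIV")
      case True
      then show ?thesis using mono[of j] by auto
    next
      case False
      then have "U (Suc j) \<noteq> U j" using stable[of j "p ^ r"] all[of j] by auto
      with mono[of j] have "card (U j) < card (U (Suc j))"
        by (intro psubset_card_mono) auto
      then have "dim (U j) < dim (U (Suc j))"
        unfolding card_U using prime_gt_1_nat[OF p] by (simp add: power_strict_increasing_iff)
      then have "p ^ Suc (dim (U j)) \<le> p ^ dim (U (Suc j))"
        using prime_ge_1_nat[OF p] by (intro power_increasing) auto
      then have "p * card (U j) \<le> card (U (Suc j))" by (simp add: card_U)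
      moreover have "p * (p ^ j * card K) \<le> p * card (U j)"
        using False Suc.IH by (intro mult_left_mono) auto
      ultimately have "p ^ Suc j * card K \<le> card (U (Suc j))" by (simp only: power_Suc mult.assoc)
      then show ?thesis ..
    qed
  qed
  \<comment> \<open>At stage s the lower bound p^s * card K is already the size of the
    field.\<close>
  have "U s = UNIV"
    using step[of s] index by (metis card_seteq finite subset_UNIV p_def)
  then show ?thesis by (auto simp: U_def D_def)
qed

text \<open>Otherwise p^(s-1) - 1 is at least s, and the sum, being D^(p^(s-1) - 1) t with D = g -
  1, falls into K.\<close>

lemma prime_power_codim_le:
  fixes g :: "'a::{field,finite} \<Rightarrow> 'a"
  assumes card: "CARD('a) = CARD('p::prime_card) ^ m"
    and g: "Modules.additive g" and period: "\<And>x. (g ^^ (CARD('p) ^ r)) x = x"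
    and K: "module.subspace (prime_scale :: 'p mod_ring \<Rightarrow> 'a \<Rightarrow> 'a) K" "g ` K \<subseteq> K"
    and index: "CARD('a) = CARD('p) ^ s * card K"
    and t: "(\<Sum>i<CARD('p) ^ (s - 1). (g ^^ i) t) \<notin> K"
  shows "CARD('p) ^ (s - 1) \<le> s"
proof (rule ccontr)
  let ?n = "CARD('p) ^ (s - 1)"
  assume "\<not> ?n \<le> s"
  then have n: "?n - 1 = s + (?n - 1 - s)" by simp
  have "(\<Sum>i<?n. (g ^^ i) t) = ((\<lambda>x. g x - x) ^^ (?n - 1)) t"
    by (rule sum_funpow_prime_power[OF g prime_card of_nat_CARD_eq_0[OF card]])
  also have "\<dots> \<in> K"
    by (subst n, subst funpow_add) (simp add: funpow_diff_mem_subgroup[OF assms(1-6)])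
  finally show False using t by simp
qed

text \<open>For s >= 2 exponential growth leaves only p = s = 2.\<close>

lemma prime_power_le_imp_le:
  fixes p s :: nat
  assumes "prime p" "p ^ (s - 1) \<le> s"
  shows "s \<le> 2" and "odd p \<Longrightarrow> s \<le> 1"
proof -
  have less: "Suc (Suc n) < b ^ Suc n" if "2 \<le> b" "3 \<le> b + n" for b n :: nat
    using that
  proof (induction n)
    case (Suc n)
    show ?case
    proof (cases "3 \<le> b + n")
      case True
      with Suc have "Suc (Suc n) < b ^ Suc n" by simp
      then have "2 * Suc (Suc (Suc n)) \<le> b * b ^ Suc n"
        using Suc.prems by (intro mult_mono) auto
      then show ?thesis by simp
    next
      \<comment> \<open>The inequality fails at b = 2, n = 0, so for b = 2 the induction starts at n
        = 1, checked directly.\<close>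
      case False
      with Suc.prems have "b = 2" "n = 0" by auto
      then show ?thesis by simp
    qed
  qed simp
  have p: "2 \<le> p" using assms(1) by (rule prime_ge_2_nat)
  have "p + s \<le> 4" if "2 \<le> s"
  proof (rule ccontr)
    assume "\<not> p + s \<le> 4"
    then have "Suc (Suc (s - 2)) < p ^ Suc (s - 2)" using p that by (intro less) auto
    moreover have "Suc (Suc (s - 2)) = s" "Suc (s - 2) = s - 1" using that by auto
    ultimately show False using assms(2) by simp
  qed
  with p show "s \<le> 2" and "odd p \<Longrightarrow> s \<le> 1" by (cases "2 \<le> s"; cases "p = 2"; auto)+
qed

section \<open>Cocycles with values in a finite field\<close>

interpretation field_aut: group "field_aut_group :: ('a::field \<Rightarrow> 'a) monoid"
  by (rule group_field_aut_group)

lemma field_aut_one: "\<one>\<^bsub>field_aut_group\<^esub> = id"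
  by (simp add: field_aut_group_def)

text \<open>The matrix group is abstracted to a homomorphism and a crossed homomorphism;
  automorphisms act on the right, so the twist falls on the left factor.\<close>

locale field_aut_cocycle = group G for G :: "('g, 'm) monoid_scheme" (structure) +
  fixes \<theta> :: "'g \<Rightarrow> 'a::{field,finite} \<Rightarrow> 'a" and c :: "'g \<Rightarrow> 'a"
  assumes \<theta>_hom: "\<theta> \<in> hom G field_aut_group"
    and cocycle: "x \<in> carrier G \<Longrightarrow> y \<in> carrier G \<Longrightarrow> c (x \<otimes> y) = \<theta> y (c x) + c y"
begin

sublocale \<theta>: group_hom G field_aut_group \<theta>
  by unfold_locales (rule \<theta>_hom)

lemma \<theta>_mult_apply: "x \<in> carrier G \<Longrightarrow> y \<in> carrier G \<Longrightarrow> \<theta> (x \<otimes> y) z = \<theta> y (\<theta> x z)"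
  by (simp add: \<theta>.hom_mult) (simp add: field_aut_group_def)

lemma \<theta>_one: "\<theta> \<one> = id"
  unfolding \<theta>.hom_one by (rule field_aut_one)

lemma \<theta>_add: "x \<in> carrier G \<Longrightarrow> \<theta> x (a + b) = \<theta> x a + \<theta> x b"
  by (rule field_aut_add[OF \<theta>.hom_closed])

lemma \<theta>_0: "x \<in> carrier G \<Longrightarrow> \<theta> x 0 = 0"
  using \<theta>_add[of x 0 0] by (metis add.right_neutral add_left_cancel)

lemma c_one: "c \<one> = 0"
  using cocycle[of \<one> \<one>] by (metis \<theta>_one add_cancel_right_left id_apply one_closed r_one)

lemma c_inv: "k \<in> carrier G \<Longrightarrow> c k = 0 \<Longrightarrow> c (inv k) = 0"
  using cocycle[of k "inv k"] \<theta>_0[of "inv k"] by (simp add: c_one)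

lemma c_pow: "x \<in> carrier G \<Longrightarrow> c (x [^] n) = (\<Sum>j<n. (\<theta> x ^^ j) (c x))"
proof (induction n)
  case (Suc n)
  have "\<theta> x (sum f A) = (\<Sum>j\<in>A. \<theta> x (f j))" for f :: "nat \<Rightarrow> 'a" and A
    by (induction A rule: infinite_finite_induct) (simp_all add: Suc.prems \<theta>_0 \<theta>_add)
  with Suc show ?case
    by (simp add: cocycle sum.lessThan_Suc_shift add.commute del: sum.lessThan_Suc)
qed (simp add: c_one)

text \<open>This set will turn out to be \<open>K 0\<close>. On the kernel of \<theta> the cocycle
  identity is plain additivity, which makes the image an additive subgroup.\<close>

definition ker_values :: "'a set" where
  "ker_values = c ` {u \<in> carrier G. \<theta> u = id}"

lemma zero_in_ker_values: "0 \<in> ker_values"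
  unfolding ker_values_def using \<theta>_one c_one by (auto intro!: image_eqI[of _ _ \<one>])

lemma ker_values_add: "a \<in> ker_values \<Longrightarrow> b \<in> ker_values \<Longrightarrow> a + b \<in> ker_values"
proof -
  assume "a \<in> ker_values" "b \<in> ker_values"
  then obtain u v where u: "u \<in> carrier G" "\<theta> u = id" "a = c u"
    and v: "v \<in> carrier G" "\<theta> v = id" "b = c v"
    by (auto simp: ker_values_def)
  have "\<theta> (u \<otimes> v) = id" using u v by (intro ext) (simp only: \<theta>_mult_apply id_apply)
  then show ?thesis
    unfolding ker_values_def using u v
    by (auto simp: cocycle intro!: image_eqI[of _ _ "u \<otimes> v"])
qed

text \<open>Conjugating a kernel element u by y stays in the kernel, and as \<theta> u = id the
  contributions of y and its inverse cancel, leaving \<theta> y (c u).\<close>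

lemma ker_values_invariant:
  assumes "a \<in> ker_values" "y \<in> carrier G"
  shows "\<theta> y a \<in> ker_values"
proof -
  obtain u where u: "u \<in> carrier G" "\<theta> u = id" "a = c u"
    using assms by (auto simp: ker_values_def)
  have "\<theta> (inv y \<otimes> u \<otimes> y) z = \<theta> (inv y \<otimes> y) z" for z
    using u assms(2) by (simp only: \<theta>_mult_apply m_closed inv_closed id_apply)
  then have "\<theta> (inv y \<otimes> u \<otimes> y) = id"
    using assms(2) by (simp add: fun_eq_iff field_aut_one)
  moreover have "c (inv y \<otimes> u \<otimes> y) = \<theta> y (c u) + c (inv y \<otimes> y)"
    using u assms(2) by (simp only: cocycle m_closed inv_closed id_apply \<theta>_add) simp
  ultimately show ?thesis
    unfolding ker_values_def using u assms(2)
    by (auto simp: c_one intro!: image_eqI[of _ _ "inv y \<otimes> u \<otimes> y"])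
qed

text \<open>N1 and N2 say that the automorphisms killed by N are exactly the \<theta> k with c k =
  0. Automorphisms commute, so taking N-th powers is multiplicative and the question reduces to a
  quotient of group elements.\<close>

lemma \<theta>_pow_eq_iff:
  assumes N1: "\<And>k. k \<in> carrier G \<Longrightarrow> c k = 0 \<Longrightarrow> \<theta> k [^]\<^bsub>field_aut_group\<^esub> (N::nat) = \<one>\<^bsub>field_aut_group\<^esub>"
    and N2: "\<And>\<rho>. \<rho> \<in> carrier field_aut_group \<Longrightarrow> \<rho> [^]\<^bsub>field_aut_group\<^esub> N = \<one>\<^bsub>field_aut_group\<^esub>
      \<Longrightarrow> \<exists>k\<in>carrier G. c k = 0 \<and> \<theta> k = \<rho>"
    and x: "x \<in> carrier G" and y: "y \<in> carrier G"
  shows "\<theta> x [^]\<^bsub>field_aut_group\<^esub> N = \<theta> y [^]\<^bsub>field_aut_group\<^esub> N \<longleftrightarrow> c x - c y \<in> ker_values"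
proof -
  have pow_mult: "\<theta> (u \<otimes> v) [^]\<^bsub>field_aut_group\<^esub> N
      = \<theta> u [^]\<^bsub>field_aut_group\<^esub> N \<otimes>\<^bsub>field_aut_group\<^esub> \<theta> v [^]\<^bsub>field_aut_group\<^esub> N"
    if "u \<in> carrier G" "v \<in> carrier G" for u v
    using that by (simp add: \<theta>.hom_mult field_aut.pow_mult_distrib field_aut_comm)
  have pow_closed: "\<theta> u [^]\<^bsub>field_aut_group\<^esub> N \<in> carrier field_aut_group" if "u \<in> carrier G" for u
    using that by simp
  show ?thesis
  proof
    assume eq: "\<theta> x [^]\<^bsub>field_aut_group\<^esub> N = \<theta> y [^]\<^bsub>field_aut_group\<^esub> N"
    define h where "h = x \<otimes> inv y"
    have h: "h \<in> carrier G" "x = h \<otimes> y" using x y by (simp_all add: h_def m_assoc)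
    have "\<theta> h [^]\<^bsub>field_aut_group\<^esub> N \<otimes>\<^bsub>field_aut_group\<^esub> \<theta> y [^]\<^bsub>field_aut_group\<^esub> N
        = \<theta> y [^]\<^bsub>field_aut_group\<^esub> N"
      using eq h y pow_mult by simp
    then have "\<theta> h [^]\<^bsub>field_aut_group\<^esub> N = \<one>\<^bsub>field_aut_group\<^esub>"
      using h y by (simp add: field_aut.r_cancel_one')
    then obtain k where k: "k \<in> carrier G" "c k = 0" "\<theta> k = \<theta> h"
      using N2[of "\<theta> h"] h by auto
    \<comment> \<open>\<open>inv k\<close> has value 0, so multiplying by it makes \<theta> trivial
      without changing the value of h.\<close>
    define u where "u = inv k \<otimes> h"
    have u: "u \<in> carrier G" "c u = c h"
      using h k by (simp_all add: u_def cocycle c_inv \<theta>_0)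
    have "\<theta> u = id"
      using \<theta>.hom_mult[of "inv k" h] \<theta>.hom_mult[of "inv k" k] k h by (simp add: u_def field_aut_one)
    then have "c h \<in> ker_values" unfolding ker_values_def using u by (metis (mono_tags, lifting) image_eqI mem_Collect_eq)
    then show "c x - c y \<in> ker_values"
      using ker_values_invariant[of "c h" y] h y by (simp add: cocycle)
  next
    assume "c x - c y \<in> ker_values"
    then obtain u where u: "u \<in> carrier G" "\<theta> u = id" "c x - c y = c u"
      by (auto simp: ker_values_def)
    \<comment> \<open>\<open>y \<otimes> u\<close> has the same value as x, so the quotient k has
      value 0 and N1 applies.\<close>
    define k where "k = x \<otimes> inv (y \<otimes> u)"
    have k: "k \<in> carrier G" "x = k \<otimes> (y \<otimes> u)"
      using x y u by (simp_all add: k_def m_assoc)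
    have "c x = \<theta> (y \<otimes> u) (c k) + c (y \<otimes> u)" using k y u by (simp add: cocycle)
    moreover have "c (y \<otimes> u) = c x" using u y by (simp add: cocycle algebra_simps)
    ultimately have "\<theta> (y \<otimes> u) (c k) = \<theta> (y \<otimes> u) 0"
      using y u \<theta>_0[of "y \<otimes> u"] by simp
    then have "c k = 0"
      using bij_is_inj[OF field_aut_bij[OF \<theta>.hom_closed[of "y \<otimes> u"]]] y u by (auto dest: injD)
    then have "\<theta> k [^]\<^bsub>field_aut_group\<^esub> N = \<one>\<^bsub>field_aut_group\<^esub>" using N1 k by simp
    moreover have "\<theta> u [^]\<^bsub>field_aut_group\<^esub> N = \<one>\<^bsub>field_aut_group\<^esub>"
      using u(2) field_aut.nat_pow_one by (metis \<theta>.hom_one \<theta>_one)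
    ultimately show "\<theta> x [^]\<^bsub>field_aut_group\<^esub> N = \<theta> y [^]\<^bsub>field_aut_group\<^esub> N"
      using k(1) y u(1) pow_closed[OF y]
      by (simp only: k(2) pow_mult m_closed field_aut.l_one field_aut.r_one)
  qed
qed

end

section \<open>The group of semilinear maps\<close>

lemma vector_4:
  "(vector [w, x, y, z] :: 'a::zero ^ 4) $ 1 = w"
  "(vector [w, x, y, z] :: 'a::zero ^ 4) $ 2 = x"
  "(vector [w, x, y, z] :: 'a::zero ^ 4) $ 3 = y"
  "(vector [w, x, y, z] :: 'a::zero ^ 4) $ 4 = z"
  unfolding vector_def by simp_all

text \<open>The product of two elements is read off the last row of the product matrix; the entry in row
  3, column 2 gives the cocycle identity for \<open>T\<close>.\<close>

definition triple_group ::
  "('a::field \<Rightarrow> 'a \<Rightarrow> 'a \<Rightarrow> 'a) \<Rightarrow> ('a \<Rightarrow> 'a \<Rightarrow> 'a \<Rightarrow> 'a \<Rightarrow> 'a) \<Rightarrow> ('a \<times> 'a \<times> 'a) monoid" where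
  "triple_group T \<theta> =
    \<lparr> carrier = UNIV,
      monoid.mult = (\<lambda>(a, b, c) (a', b', c').
        (\<theta> a' b' c' a + a' - \<theta> a' b' c' b * c' + \<theta> a' b' c' c * (b' - c' * T a' b' c'),
         \<theta> a' b' c' b + b' + \<theta> a' b' c' c * T a' b' c',
         \<theta> a' b' c' c + c')),
      one = (0, 0, 0) \<rparr>"

lemma G_set_closed_imp:
  fixes T :: "'a::{field,finite} \<Rightarrow> 'a \<Rightarrow> 'a \<Rightarrow> 'a"
  assumes aut: "\<And>a b c. \<theta> a b c \<in> carrier field_aut_group"
    and closed: "\<And>g h. g \<in> G_set T \<theta> \<Longrightarrow> h \<in> G_set T \<theta> \<Longrightarrow> semilin_mult g h \<in> G_set T \<theta>"
    and prod: "(a, b, c) \<otimes>\<^bsub>triple_group T \<theta>\<^esub> (a', b', c') = (a'', b'', c'')"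
  shows "\<theta> a'' b'' c'' = \<theta> a' b' c' \<circ> \<theta> a b c"
    and "T a'' b'' c'' = \<theta> a' b' c' (T a b c) + T a' b' c'"
proof -
  interpret comm_ring_hom "\<theta> a' b' c'" by (rule field_aut_comm_ring_hom[OF aut])
  have "semilin_mult (g_elem T \<theta> a b c) (g_elem T \<theta> a' b' c') \<in> G_set T \<theta>"
    by (intro closed) (auto simp: G_set_def)
  then obtain u v w where uvw:
      "semilin_mult (g_elem T \<theta> a b c) (g_elem T \<theta> a' b' c') = g_elem T \<theta> u v w"
    by (auto simp: G_set_def)
  let ?M = "map_matrix (\<theta> a' b' c') (E_mat a b c (T a b c)) ** E_mat a' b' c' (T a' b' c')"
  have M: "?M = E_mat u v w (T u v w)" and \<theta>: "\<theta> u v w = \<theta> a' b' c' \<circ> \<theta> a b c"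
    using uvw by (simp_all add: semilin_mult_def g_elem_def field_aut_group_def)
  have "?M $ i $ j = E_mat u v w (T u v w) $ i $ j" for i j by (simp add: M)
  from this[of 4 1] this[of 4 2] this[of 4 3] this[of 3 2]
  have "(u, v, w) = (a'', b'', c'')" and "T u v w = \<theta> a' b' c' (T a b c) + T a' b' c'"
    using prod
    by (auto simp: triple_group_def matrix_matrix_mult_def sum_4 E_mat_def vector_4 hom_distribs
        algebra_simps)
  with \<theta> show "\<theta> a'' b'' c'' = \<theta> a' b' c' \<circ> \<theta> a b c"
    and "T a'' b'' c'' = \<theta> a' b' c' (T a b c) + T a' b' c'"
    by auto
qed

lemma field_aut_cocycle_triple_group:
  fixes T :: "'a::{field,finite} \<Rightarrow> 'a \<Rightarrow> 'a \<Rightarrow> 'a"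
  assumes aut: "\<And>a b c. \<theta> a b c \<in> carrier field_aut_group"
    and closed: "\<And>g h. g \<in> G_set T \<theta> \<Longrightarrow> h \<in> G_set T \<theta> \<Longrightarrow> semilin_mult g h \<in> G_set T \<theta>"
  shows "field_aut_cocycle (triple_group T \<theta>) (\<lambda>(a, b, c). \<theta> a b c) (\<lambda>(a, b, c). c)"
proof -
  let ?G = "triple_group T \<theta>"
  have mult: "\<theta> a'' b'' c'' = \<theta> a' b' c' \<circ> \<theta> a b c"
      "T a'' b'' c'' = \<theta> a' b' c' (T a b c) + T a' b' c'"
    if "(a, b, c) \<otimes>\<^bsub>?G\<^esub> (a', b', c') = (a'', b'', c'')" for a b c a' b' c' a'' b'' c''
    using G_set_closed_imp[OF aut _ that] closed by blast+
  note hom = field_aut_comm_ring_hom[OF aut]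
  have hom_simps: "\<theta> a b c (x + y) = \<theta> a b c x + \<theta> a b c y"
    "\<theta> a b c (x - y) = \<theta> a b c x - \<theta> a b c y"
    "\<theta> a b c (x * y) = \<theta> a b c x * \<theta> a b c y" "\<theta> a b c 0 = 0" for a b c x y
  proof -
    interpret comm_ring_hom "\<theta> a b c" by (rule hom)
    show "\<theta> a b c (x + y) = \<theta> a b c x + \<theta> a b c y"
      "\<theta> a b c (x - y) = \<theta> a b c x - \<theta> a b c y"
      "\<theta> a b c (x * y) = \<theta> a b c x * \<theta> a b c y" "\<theta> a b c 0 = 0"
      by (simp_all add: hom_distribs)
  qed
  have inj: "\<theta> a b c x = \<theta> a b c y \<longleftrightarrow> x = y" for a b c x y
    using bij_is_inj[OF field_aut_bij[OF aut]] by (auto dest: injD)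
  have "group ?G"
  proof (rule groupI)
    fix x y z :: "'a \<times> 'a \<times> 'a"
    obtain a b c where x: "x = (a, b, c)" by (cases x)
    obtain a' b' c' where y: "y = (a', b', c')" by (cases y)
    obtain a'' b'' c'' where z: "z = (a'', b'', c'')" by (cases z)
    \<comment> \<open>The product of y and z stays an opaque triple while \<theta> and T are
      rewritten by their laws; its coordinates are inserted last.\<close>
    obtain u v w where uvw: "y \<otimes>\<^bsub>?G\<^esub> z = (u, v, w)" by (cases "y \<otimes>\<^bsub>?G\<^esub> z")
    have \<theta>: "\<theta> u v w = \<theta> a'' b'' c'' \<circ> \<theta> a' b' c'"
      and T: "T u v w = \<theta> a'' b'' c'' (T a' b' c') + T a'' b'' c''"
      using mult[OF uvw[unfolded y z]] by auto
    have uvw': "u = \<theta> a'' b'' c'' a' + a'' - \<theta> a'' b'' c'' b' * c''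
        + \<theta> a'' b'' c'' c' * (b'' - c'' * T a'' b'' c'')"
      "v = \<theta> a'' b'' c'' b' + b'' + \<theta> a'' b'' c'' c' * T a'' b'' c''"
      "w = \<theta> a'' b'' c'' c' + c''"
      using uvw by (auto simp: triple_group_def y z)
    have "x \<otimes>\<^bsub>?G\<^esub> y \<otimes>\<^bsub>?G\<^esub> z = x \<otimes>\<^bsub>?G\<^esub> (u, v, w)"
      unfolding x y z
      by (simp add: triple_group_def \<theta> T hom_simps) (simp add: uvw' algebra_simps)
    then show "x \<otimes>\<^bsub>?G\<^esub> y \<otimes>\<^bsub>?G\<^esub> z = x \<otimes>\<^bsub>?G\<^esub> (y \<otimes>\<^bsub>?G\<^esub> z)"
      by (simp add: uvw)
  next
    fix x :: "'a \<times> 'a \<times> 'a"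
    obtain a b c where x: "x = (a, b, c)" by (cases x)
    show "\<one>\<^bsub>?G\<^esub> \<otimes>\<^bsub>?G\<^esub> x = x"
      by (simp add: triple_group_def x hom_simps)
    \<comment> \<open>Left inverses come from finiteness: right multiplication is injective, hence
      surjective.\<close>
    have "inj (\<lambda>y. y \<otimes>\<^bsub>?G\<^esub> x)"
      by (rule injI) (auto simp: triple_group_def x inj)
    then have "surj (\<lambda>y. y \<otimes>\<^bsub>?G\<^esub> x)" by (intro finite_UNIV_inj_surj) auto
    then obtain y where "y \<otimes>\<^bsub>?G\<^esub> x = \<one>\<^bsub>?G\<^esub>" by (metis surjD)
    then show "\<exists>y\<in>carrier ?G. y \<otimes>\<^bsub>?G\<^esub> x = \<one>\<^bsub>?G\<^esub>"
      by (intro bexI[of _ y]) (simp_all add: triple_group_def)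
  qed (simp_all add: triple_group_def)
  then interpret G: group ?G .
  show ?thesis
  proof unfold_locales
    show "(\<lambda>(a, b, c). \<theta> a b c) \<in> hom ?G field_aut_group"
    proof (rule homI)
      fix x y :: "'a \<times> 'a \<times> 'a"
      show "(\<lambda>(a, b, c). \<theta> a b c) x \<in> carrier field_aut_group"
        by (cases x) (simp add: aut)
      show "(\<lambda>(a, b, c). \<theta> a b c) (x \<otimes>\<^bsub>?G\<^esub> y)
          = (\<lambda>(a, b, c). \<theta> a b c) x \<otimes>\<^bsub>field_aut_group\<^esub> (\<lambda>(a, b, c). \<theta> a b c) y"
        by (cases x; cases y; cases "x \<otimes>\<^bsub>?G\<^esub> y")
          (use mult(1) in \<open>auto simp: field_aut_group_def\<close>)
    qed
  qed (auto simp: triple_group_def)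
qed

section \<open>Prime power orders and exponents\<close>

lemma (in group) ord_eq_prime_power:
  assumes "x \<in> carrier G" "prime p" "x [^] (p ^ Suc r) = \<one>" "x [^] (p ^ r) \<noteq> \<one>"
  shows "ord x = p ^ Suc r"
proof -
  obtain i where i: "i \<le> Suc r" "ord x = p ^ i"
    using assms pow_eq_id divides_primepow_nat by metis
  have "\<not> i \<le> r" using assms pow_eq_id i by (metis le_imp_power_dvd)
  then show ?thesis using i by (simp add: le_Suc_eq)
qed

text \<open>By minimality p^(r-1) fails to be an exponent, so some element survives it and has order
  exactly p^r; for r = 0 the identity serves. The bound n ensures that a least exponent
  exists.\<close>

lemma (in group) obtain_ord_eq_exponent_in:
  assumes S: "S \<subseteq> carrier G" "\<one> \<in> S" and p: "prime p"
    and exp: "p ^ r = exponent_in G S" and ex: "(n::nat) > 0" "\<And>x. x \<in> S \<Longrightarrow> x [^] n = \<one>"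
  obtains h where "h \<in> S" "ord h = p ^ r" "\<And>x. x \<in> S \<Longrightarrow> x [^] (p ^ r) = \<one>"
proof -
  let ?P = "\<lambda>n::nat. 0 < n \<and> (\<forall>x\<in>S. x [^] n = \<one>)"
  have "?P (LEAST n. ?P n)" using ex by (intro LeastI[of ?P n]) auto
  then have pow: "x [^] (p ^ r) = \<one>" if "x \<in> S" for x
    using that by (simp add: exp exponent_in_def)
  show ?thesis
  proof (cases r)
    case 0
    then show ?thesis using that[OF S(2)] pow by simp
  next
    case (Suc k)
    have "p ^ k < (LEAST n. ?P n)"
      using prime_gt_1_nat[OF p] unfolding exp[unfolded exponent_in_def, symmetric] Suc by simp
    then have "\<not> ?P (p ^ k)" by (rule not_less_Least)
    then obtain h where "h \<in> S" "h [^] (p ^ k) \<noteq> \<one>"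
      using p by (auto simp: prime_gt_0_nat)
    then show ?thesis
      using that[of h] pow ord_eq_prime_power[of h p k] p S(1) Suc by auto
  qed
qed

theorem theorem5p7:
  fixes T :: "'a::{field,finite} \<Rightarrow> 'a \<Rightarrow> 'a \<Rightarrow> 'a"
    and \<theta> :: "'a \<Rightarrow> 'a \<Rightarrow> 'a \<Rightarrow> 'a \<Rightarrow> 'a"
    and p m q r_AB r_C s :: nat
    and t_C :: 'a and g_C :: "'a \<Rightarrow> 'a" and K :: "nat \<Rightarrow> 'a set"
  assumes p: "p = CARD('p::prime_card)"
    and q: "q = p ^ m" "CARD('a) = q"
    and \<theta>_aut: "\<And>a b c. \<theta> a b c \<in> carrier field_aut_group"
    and closed: "\<And>g h. g \<in> G_set T \<theta> \<Longrightarrow> h \<in> G_set T \<theta> \<Longrightarrow> semilin_mult g h \<in> G_set T \<theta>"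
    and nontrivial: "\<exists>a b c. \<theta> a b c \<noteq> id"
    and r_AB: "p ^ r_AB = exponent_in field_aut_group (psi_AB T \<theta>)"
    and r_C: "p ^ r_C = Max {group.ord field_aut_group (sigma_C \<theta> c) | c. True}"
    and g_C: "g_C = sigma_C \<theta> t_C" "group.ord field_aut_group g_C = p ^ r_C"
    and K: "\<And>i. K i = {z. sigma_C \<theta> z [^]\<^bsub>field_aut_group\<^esub> (p ^ r_AB)
                        = g_C [^]\<^bsub>field_aut_group\<^esub> (i * p ^ r_AB)}"
    and s: "s = nat (max 0 (int r_C - int r_AB))"
  shows "(even q \<longrightarrow> r_C \<le> r_AB + 2) \<and>
    (odd q \<longrightarrow>
      r_C \<le> r_AB + 1 \<and>
      module.subspace (prime_scale :: 'p mod_ring \<Rightarrow> 'a \<Rightarrow> 'a) (K 0) \<and>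
      g_C ` K 0 \<subseteq> K 0 \<and>
      vector_space.dim (prime_scale :: 'p mod_ring \<Rightarrow> 'a \<Rightarrow> 'a) (K 0) + s
        = vector_space.dim (prime_scale :: 'p mod_ring \<Rightarrow> 'a \<Rightarrow> 'a) UNIV \<and>
      (\<forall>i\<ge>1. K i = (\<lambda>z. (\<Sum>j<i. (g_C [^]\<^bsub>field_aut_group\<^esub> j) t_C) + z) ` K 0))"
proof -
  let ?A = "field_aut_group :: ('a \<Rightarrow> 'a) monoid"
  let ?G = "triple_group T \<theta>"
  let ?\<Theta> = "\<lambda>(a, b, c). \<theta> a b c" and ?c = "\<lambda>(a, b, c). c"
  interpret G: field_aut_cocycle ?G ?\<Theta> ?c
    by (rule field_aut_cocycle_triple_group) (use \<theta>_aut closed in auto)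
  have carrier_G [simp]: "x \<in> carrier ?G" for x by (simp add: triple_group_def)
  have prime: "prime p" unfolding p by (rule prime_card)
  have card: "CARD('a) = CARD('p) ^ m" using p q by simp
  have order_G: "order ?G = p ^ (3 * m)"
    using q by (simp add: order_def triple_group_def card_cartesian_product power3_eq_cube power_mult
        mult.commute flip: UNIV_Times_UNIV)
  \<comment> \<open>By Lagrange in the group of order q^3 all these automorphisms have p-power
    order, and the exponent of \<open>psi_AB\<close> exists.\<close>
  have \<Theta>_order: "?\<Theta> x [^]\<^bsub>?A\<^esub> (p ^ (3 * m)) = \<one>\<^bsub>?A\<^esub>" for x
    using G.pow_order_eq_1[of x] G.\<theta>.hom_nat_pow[of x "p ^ (3 * m)"]
    unfolding order_G by simp

  \<comment> \<open>Automorphisms killed by \<open>N\<close>\<close>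
  define N where "N = p ^ r_AB"

  have psi: "psi_AB T \<theta> = ?\<Theta> ` {x. ?c x = 0}"
  proof -
    have "{x. ?c x = 0} = {(a, b, 0) | a b. True}" by auto
    then show ?thesis by (auto simp: psi_AB_def g_elem_def image_iff) blast+
  qed
  have "\<one>\<^bsub>?A\<^esub> \<in> psi_AB T \<theta>"
    using G.\<theta>.hom_one G.c_one unfolding psi by (metis (mono_tags, lifting) image_eqI mem_Collect_eq)
  moreover have "psi_AB T \<theta> \<subseteq> carrier ?A" using \<theta>_aut by (auto simp: psi)
  moreover have "y [^]\<^bsub>?A\<^esub> (p ^ (3 * m)) = \<one>\<^bsub>?A\<^esub>" if "y \<in> psi_AB T \<theta>" for y
    using that \<Theta>_order unfolding psi by blast
  ultimately obtain h where h: "h \<in> psi_AB T \<theta>" "field_aut.ord h = N"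
      and N: "\<And>y. y \<in> psi_AB T \<theta> \<Longrightarrow> y [^]\<^bsub>?A\<^esub> N = \<one>\<^bsub>?A\<^esub>"
    using field_aut.obtain_ord_eq_exponent_in[OF _ _ prime r_AB, of "p ^ (3 * m)"]
      prime_gt_0_nat[OF prime] unfolding N_def by (metis zero_less_power)
  from h(1) obtain k where k: "?c k = 0" "h = ?\<Theta> k" by (auto simp: psi)
  have N1: "?\<Theta> x [^]\<^bsub>?A\<^esub> N = \<one>\<^bsub>?A\<^esub>" if "?c x = 0" for x
    using N that by (auto simp: psi)
  \<comment> \<open>h has order exactly N, so its powers exhaust the automorphisms killed by N; they
    come from powers of k, whose last coordinate is still 0.\<close>
  have N2: "\<exists>x\<in>carrier ?G. ?c x = 0 \<and> ?\<Theta> x = \<rho>"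
    if \<rho>: "\<rho> \<in> carrier ?A" "\<rho> [^]\<^bsub>?A\<^esub> N = \<one>\<^bsub>?A\<^esub>" for \<rho>
  proof -
    obtain j :: nat where j: "\<rho> = h [^]\<^bsub>?A\<^esub> j"
      using field_aut_pow_ord_eq_one_imp_power[of h \<rho>] \<rho>
        G.\<theta>.hom_closed[OF carrier_G, of k, folded k(2)] unfolding h(2) by blast
    have "(?\<Theta> k ^^ i) 0 = 0" for i
      by (induction i) (simp_all add: G.\<theta>_0)
    then have "?c (k [^]\<^bsub>?G\<^esub> j) = 0" by (simp add: G.c_pow k)
    moreover have "?\<Theta> (k [^]\<^bsub>?G\<^esub> j) = \<rho>" using j k by (simp add: G.\<theta>.hom_nat_pow)
    ultimately show ?thesis by (intro bexI[of _ "k [^]\<^bsub>?G\<^esub> j"]) auto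
  qed
  have pow_eq_iff: "?\<Theta> x [^]\<^bsub>?A\<^esub> N = ?\<Theta> y [^]\<^bsub>?A\<^esub> N \<longleftrightarrow> ?c x - ?c y \<in> G.ker_values" for x y
    by (rule G.\<theta>_pow_eq_iff[OF N1 N2]) auto

  \<comment> \<open>The sets \<open>K i\<close> as cosets\<close>
  let ?V = "G.ker_values"
  define x where "x = (0 :: 'a, 0 :: 'a, t_C)"
  have g: "g_C = ?\<Theta> x" by (simp add: x_def g_C sigma_C_def)
  have g_carrier: "g_C \<in> carrier ?A" unfolding g by (rule G.\<theta>.hom_closed) simp
  define S where "S i = (\<Sum>j<i. (g_C [^]\<^bsub>?A\<^esub> j) t_C)" for i :: nat
  have c_pow: "?c (x [^]\<^bsub>?G\<^esub> i) = S i" for i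
    using G.c_pow[of x i] g by (simp add: S_def x_def field_aut_pow)
  have g_pow: "g_C [^]\<^bsub>?A\<^esub> (i * N) = ?\<Theta> (x [^]\<^bsub>?G\<^esub> i) [^]\<^bsub>?A\<^esub> N" for i :: nat
    using g_carrier by (simp add: G.\<theta>.hom_nat_pow field_aut.nat_pow_pow g)
  \<comment> \<open>Membership compares (0, 0, z) with x^i, whose last coordinates are z and
    \<open>S i\<close>.\<close>
  have K_eq: "K i = {z. z - S i \<in> ?V}" for i
  proof -
    have "sigma_C \<theta> z [^]\<^bsub>?A\<^esub> N = g_C [^]\<^bsub>?A\<^esub> (i * N) \<longleftrightarrow> z - S i \<in> ?V" for z
      unfolding g_pow using pow_eq_iff[of "(0, 0, z)" "x [^]\<^bsub>?G\<^esub> i"]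
      by (simp add: sigma_C_def c_pow)
    then show ?thesis by (simp add: K N_def)
  qed
  have K_0: "K 0 = ?V" by (simp add: K_eq S_def)
  have K_image: "K i = (\<lambda>z. S i + z) ` K 0" for i
    by (force simp: K_eq S_def image_iff)
  have subspace: "module.subspace (prime_scale :: 'p mod_ring \<Rightarrow> 'a \<Rightarrow> 'a) (K 0)"
    unfolding K_0
    by (rule add_closed_imp_subspace_prime_scale[OF card G.zero_in_ker_values G.ker_values_add])
  have invariant: "g_C ` K 0 \<subseteq> K 0"
    unfolding K_0 g using G.ker_values_invariant[of _ x] by auto

  \<comment> \<open>The codimension of \<open>K 0\<close>\<close>
  \<comment> \<open>g_C^N has order p^s; if r_C <= r_AB it is trivial and s = 0.\<close>
  have ord_g: "g_C [^]\<^bsub>?A\<^esub> (i * N) = \<one>\<^bsub>?A\<^esub> \<longleftrightarrow> p ^ s dvd i" for i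
  proof -
    have "g_C [^]\<^bsub>?A\<^esub> (i * N) = \<one>\<^bsub>?A\<^esub> \<longleftrightarrow> p ^ r_C dvd p ^ r_AB * i"
      using g_carrier g_C(2) by (simp add: field_aut.pow_eq_id N_def mult.commute)
    also have "\<dots> \<longleftrightarrow> p ^ s dvd i"
    proof (cases "r_C \<le> r_AB")
      case True
      then show ?thesis using s by (simp add: le_imp_power_dvd dvd_mult2)
    next
      case False
      then have "r_C = r_AB + s" using s by simp
      then show ?thesis using prime_gt_0_nat[OF prime] by (simp add: power_add)
    qed
    finally show ?thesis .
  qed
  have g_add: "g_C [^]\<^bsub>?A\<^esub> ((i + j) * N) = g_C [^]\<^bsub>?A\<^esub> (i * N) \<otimes>\<^bsub>?A\<^esub> g_C [^]\<^bsub>?A\<^esub> (j * N)"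
    for i j
    using g_carrier by (simp add: field_aut.nat_pow_mult add_mult_distrib)

  \<comment> \<open>All orders are powers of p, so each divides the largest one; this makes every
    \<open>sigma_C \<theta> z\<close> a power of g_C.\<close>
  have ord_dvd: "sigma_C \<theta> z [^]\<^bsub>?A\<^esub> (p ^ r_C) = \<one>\<^bsub>?A\<^esub>" for z
  proof -
    have z: "sigma_C \<theta> z \<in> carrier ?A" by (simp add: sigma_C_def \<theta>_aut)
    have "field_aut.ord (sigma_C \<theta> z) dvd p ^ (3 * m)"
      using \<Theta>_order[of "(0, 0, z)"] z by (simp add: sigma_C_def field_aut.pow_eq_id)
    then obtain i where i: "field_aut.ord (sigma_C \<theta> z) = p ^ i"
      using prime divides_primepow_nat by metis
    have "{field_aut.ord (sigma_C \<theta> c) | c. True} = range (\<lambda>c. field_aut.ord (sigma_C \<theta> c))"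
      by auto
    then have "field_aut.ord (sigma_C \<theta> z) \<le> p ^ r_C"
      unfolding r_C by (intro Max_ge) auto
    then have "i \<le> r_C" using i prime_gt_1_nat[OF prime] by simp
    then show ?thesis using z i by (simp add: field_aut.pow_eq_id le_imp_power_dvd)
  qed
  have UN: "(\<Union>i<p ^ s. K i) = UNIV"
  proof (intro equalityI subset_UNIV subsetI)
    fix z :: 'a
    obtain j :: nat where j: "sigma_C \<theta> z = g_C [^]\<^bsub>?A\<^esub> j"
      using field_aut_pow_ord_eq_one_imp_power[OF g_carrier, of "sigma_C \<theta> z"] ord_dvd[of z] g_C(2)
        \<theta>_aut by (auto simp: sigma_C_def)
    have "sigma_C \<theta> z [^]\<^bsub>?A\<^esub> N = g_C [^]\<^bsub>?A\<^esub> ((p ^ s * (j div p ^ s) + j mod p ^ s) * N)"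
      using g_carrier by (simp add: j field_aut.nat_pow_pow)
    also have "\<dots> = g_C [^]\<^bsub>?A\<^esub> (j mod p ^ s * N)"
      unfolding g_add using ord_g[of "p ^ s * (j div p ^ s)"] g_carrier by simp
    finally have "z \<in> K (j mod p ^ s)" by (simp add: K N_def)
    then show "z \<in> (\<Union>i<p ^ s. K i)"
      using prime_gt_0_nat[OF prime] by (intro UN_I[of "j mod p ^ s"]) auto
  qed
  have disjoint: "K i \<inter> K j = {}" if "i < j" "j < p ^ s" for i j
  proof (rule ccontr)
    assume "K i \<inter> K j \<noteq> {}"
    then have "g_C [^]\<^bsub>?A\<^esub> (i * N) = g_C [^]\<^bsub>?A\<^esub> ((i + (j - i)) * N)"
      using that(1) by (auto simp: K N_def)
    then have "g_C [^]\<^bsub>?A\<^esub> ((j - i) * N) = \<one>\<^bsub>?A\<^esub>"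
      unfolding g_add using g_carrier field_aut.r_cancel_one' field_aut.l_cancel_one'
      by (metis field_aut.nat_pow_closed)
    then have "p ^ s dvd j - i" by (simp add: ord_g)
    with that show False by (auto dest: dvd_imp_le)
  qed
  have card_K: "card (K i) = card (K 0)" for i
    unfolding K_image[of i] by (intro card_image) (auto intro: inj_onI)
  \<comment> \<open>The p^s translates \<open>K i\<close> with i < p^s partition the field.\<close>
  have index: "CARD('a) = CARD('p) ^ s * card (K 0)"
  proof -
    have "K i \<inter> K j = {}" if "i < p ^ s" "j < p ^ s" "i \<noteq> j" for i j
      using disjoint[of i j] disjoint[of j i] that by (cases "i < j") auto
    then have "card (\<Union>i<p ^ s. K i) = (\<Sum>i<p ^ s. card (K i))"
      by (intro card_UN_disjoint) auto
    also have "\<dots> = p ^ s * card (K 0)" by (subst card_K) simp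
    finally show ?thesis unfolding UN by (simp add: p)
  qed

  interpret V: vector_space "prime_scale :: 'p mod_ring \<Rightarrow> 'a \<Rightarrow> 'a"
    by (rule vector_space_prime_scale[OF card])
  have "CARD('p) ^ V.dim UNIV = CARD('p) ^ (V.dim (K 0) + s)"
    using V.card_subspace[of UNIV] V.card_subspace[OF subspace] index
    by (simp add: power_add mult.commute)
  then have codim: "V.dim (K 0) + s = V.dim UNIV"
    using prime_gt_1_nat[OF prime] by (simp add: p)

  \<comment> \<open>The bounds on \<open>r_C\<close>\<close>
  \<comment> \<open>At s = 0 truncated subtraction makes the left side 1, so that case is excluded
    here and treated separately below.\<close>
  have bound: "p ^ (s - 1) \<le> s" if "s > 0"
    unfolding p
  proof (rule prime_power_codim_le[OF card _ _ subspace invariant index, of r_C t_C])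
    show "Modules.additive g_C"
      by unfold_locales (rule field_aut_add[OF g_carrier])
    show "(g_C ^^ (CARD('p) ^ r_C)) y = y" for y
    proof -
      have "g_C [^]\<^bsub>?A\<^esub> (p ^ r_C) = \<one>\<^bsub>?A\<^esub>"
        using field_aut.pow_ord_eq_1[OF g_carrier] by (simp add: g_C(2))
      then show ?thesis by (simp add: field_aut_pow p) (simp add: field_aut_group_def)
    qed
    \<comment> \<open>If \<open>S (p ^ (s - 1))\<close> were in \<open>?V\<close>, comparing
      x^(p^(s-1)) with the identity would kill g_C^N by p^(s-1), below its order p^s.\<close>
    have "\<not> p ^ s dvd p ^ (s - 1)"
      using that prime_gt_1_nat[OF prime] by (auto dest: dvd_imp_le)
    then have "S (p ^ (s - 1)) \<notin> ?V"
      using pow_eq_iff[of "x [^]\<^bsub>?G\<^esub> (p ^ (s - 1))" "\<one>\<^bsub>?G\<^esub>"] ord_g[of "p ^ (s - 1)"]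
      by (simp only: c_pow g_pow G.c_one G.\<theta>.hom_one field_aut.nat_pow_one diff_zero
          not_False_eq_True)
    then show "(\<Sum>i<CARD('p) ^ (s - 1). (g_C ^^ i) t_C) \<notin> K 0"
      by (simp add: S_def K_0 field_aut_pow p)
  qed
  have r_C_le: "r_C \<le> r_AB + s" using s by simp
  have "s \<le> 2" using prime_power_le_imp_le(1)[OF prime] bound by (cases "s > 0") auto
  moreover have "s \<le> 1" if "odd q"
  proof -
    \<comment> \<open>Two distinct elements rule out m = 0, where q = 1 is odd for every p.\<close>
    have "card {0, 1 :: 'a} \<le> CARD('a)" by (rule card_mono) auto
    then have "m \<noteq> 0" using card by (intro notI) simp
    with that have "odd p" by (simp add: q(1))
    then show ?thesis using prime_power_le_imp_le(2)[OF prime] bound by (cases "s > 0") auto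
  qed
  ultimately have "even q \<longrightarrow> r_C \<le> r_AB + 2" "odd q \<longrightarrow> r_C \<le> r_AB + 1"
    using r_C_le by force+
  then show ?thesis
    using subspace invariant codim K_image[unfolded S_def] by blast
qed

end
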